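(* Let $U\subseteq\mathbb{C}$ be open and connected, let $f$ be a nonconstant meromorphic function on $U$, and let $z_0\in U$ be a simple root of $f$ (so $f(z_0)=0\neq f'(z_0)$). Suppose $f''(z_0)\neq0$. Let $\mathcal{S}_f$ be the secant map, $\mathcal{A}(f,z_0)$ the basin of attraction of $(z_0,z_0)$, $\phi=\frac12(1+\sqrt5)$, and $\widehat{\mathcal{H}}_{f,z_0}:\mathcal{A}(f,z_0)\to\mathbb{R}$ the Böttcher-type modulus about $(z_0,z_0)$. **(1)** Define $h_{f,z_0}:\mathcal{A}(f,z_0)\to\mathbb{R}$ by $$h_{f,z_0}(x,y)=\max\left\{\widehat{\mathcal{H}}_{f,z_0}(x,y)\,|x-z_0|^{\phi/\sqrt5}\,|y-z_0|^{1/\sqrt5},\ \left[\widehat{\mathcal{H}}_{f,z_0}(x,y)\right]^{1/\phi}|x-z_0|^{1/\sqrt5}\,|y-z_0|^{\phi^{-1}/\sqrt5}\right\}.$$ Then $h_{f,z_0}$ is continuous and satisfies $h_{f,z_0}(\mathcal{S}_f(x,y))=[h_{f,z_0}(x,y)]^\phi$ for all $(x,y)\in\mathcal{A}(f,z_0)$. **(2)** For every norm $\|\cdot\|:\mathbb{C}^2\to\mathbb{R}$ on $\mathbb{C}^2$, $$h_{f,z_0}(x,y)=\lim_{n\to\infty}\left\|\mathcal{S}_f^{\circ n}(x,y)-(z_0,z_0)\right\|^{1/\phi^n}$$ for all $(x,y)\in\mathcal{A}(f,z_0)$. **(3)** $$h_{f,z_0}^{-1}(\{0\})=\bigcup_{n=0}^\infty\mathcal{S}_f^{\circ(-n)}(\{(z_0,z_0)\}),$$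 i.e. the zero set of $h_{f,z_0}$ equals the set of iterated preimages of $(z_0,z_0)$. **(4)** For all $(x,y)\in\mathcal{A}(f,z_0)$ we have $0\leq h_{f,z_0}(x,y)<1$, and $$h_{f,z_0}(x,y)=\left[\widehat{\mathcal{H}}_{f,z_0}(x,y)\right]^{1/\phi}\cdot|x-z_0|^{1/\sqrt5}\cdot|y-z_0|^{\phi^{-1}/\sqrt5}.$$
   Context: Secant map: $\mathcal{S}_f:U\times U\dashrightarrow\mathbb{P}^1\times\mathbb{P}^1$ is given by $$\mathcal{S}_f(x,y)=\left(\frac{f(x)y-f(y)x}{f(x)-f(y)},\,x\right),$$ and is extended holomorphically to all points of $U\times U$ where such an extension exists; remaining points are indeterminate and excluded from its domain. In particular $\mathcal{S}_f(x,x)=\left(x-\frac{f(x)}{f'(x)},x\right)$ if $x$ is not a pole and $f'(x)\neq0$; $\mathcal{S}_f(x,y)=(y,x)$ if $x$ is a pole of $f$ and $y$ is not; and $\mathcal{S}_f(x,y)=(x,x)$ if $y$ is a pole and $x$ is not. An iterate $\mathcal{S}_f^{\circ n}(x,y)$ is defined when the preceding iterates lie in $U\times U$ and in the domain of $\mathcal{S}_f$. For a simple root $z_0$ of $f$, $(z_0,z_0)$ is a superattracting fixed point of $\mathcal{S}_f$, and its basin of attraction is $$\mathcal{A}(f,z_0)=\left\{(x,y)\in U\times U:\ \lim_{n\to\infty}\mathcal{S}_f^{\circ n}(x,y)=(z_0,z_0)\right\}$$ (all iterates being defined and in $U\times U$). It is nonempty, open, and fully invariant under $\mathcal{S}_f$.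 For a set $E$, $\mathcal{S}_f^{\circ(-n)}(E)$ denotes the set of points $(x,y)\in U\times U$ with $\mathcal{S}_f^{\circ n}(x,y)$ defined and in $E$. Böttcher-type modulus: when $f''(z_0)\neq0$, $\widehat{\mathcal{H}}_{f,z_0}:\mathcal{A}(f,z_0)\to\mathbb{R}$ is the unique continuous function such that $$\lim_{n\to\infty}\left|(\pi_1\circ\mathcal{S}_f^{\circ n})(x,y)-z_0\right|^{1/\phi^n}=\widehat{\mathcal{H}}_{f,z_0}(x,y)\cdot|x-z_0|^{\phi/\sqrt5}\cdot|y-z_0|^{1/\sqrt5}$$ for all $(x,y)\in\mathcal{A}(f,z_0)$, where $\pi_1$ is the first coordinate projection (the limit exists on the whole basin, and such a function exists and is unique). *)

theory Defs
  imports "HOL-Complex_Analysis.Complex_Analysis"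
begin

datatype sphere = Fin (affine: complex) | Infty

text \<open>The chart change \<open>z \<mapsto> 1/z\<close> at infinity, so that \<open>inv_chart\<close> parametrizes
  a neighbourhood of \<open>Infty\<close> by a neighbourhood of \<open>0\<close>.\<close>

definition inv_chart :: "complex \<Rightarrow> sphere" where
  "inv_chart w = (if w = 0 then Infty else Fin (1 / w))"

text \<open>Holomorphic functions of two variables: the Frechet derivative exists and is
  complex linear at every point of the open set.\<close>

definition holomorphic2_on :: "(complex \<times> complex \<Rightarrow> complex) \<Rightarrow> (complex \<times> complex) set \<Rightarrow> bool" where
  "holomorphic2_on g W \<longleftrightarrow> open W \<and>
     (\<forall>p\<in>W. \<exists>a b. (g has_derivative (\<lambda>v. a * fst v + b * snd v)) (at p))"

text \<open>Holomorphic maps into the Riemann sphere, expressed in its two standard charts.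
  Continuity is implied by this condition.\<close>

definition sphere_holomorphic_on :: "(complex \<times> complex \<Rightarrow> sphere) \<Rightarrow> (complex \<times> complex) set \<Rightarrow> bool" where
  "sphere_holomorphic_on G W \<longleftrightarrow> open W \<and>
     (\<forall>p\<in>W. \<exists>V g. p \<in> V \<and> V \<subseteq> W \<and> holomorphic2_on g V \<and>
        ((\<forall>q\<in>V. G q = Fin (g q)) \<or> (\<forall>q\<in>V. G q = inv_chart (g q))))"

definition emb :: "complex \<times> complex \<Rightarrow> sphere \<times> sphere" where
  "emb p = (Fin (fst p), Fin (snd p))"

text \<open>Left inverse of \<open>emb\<close>; meaningful only on the range of \<open>emb\<close>.\<close>

definition aff :: "sphere \<times> sphere \<Rightarrow> complex \<times> complex" where
  "aff q = (affine (fst q), affine (snd q))"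

text \<open>The points at which the defining formula of the secant map can be evaluated directly.
  Poles have to be excluded by hand because a meromorphic function is represented here by a
  function \<open>complex \<Rightarrow> complex\<close>, whose value at a pole carries no meaning.\<close>

definition secant_regular :: "complex set \<Rightarrow> (complex \<Rightarrow> complex) \<Rightarrow> (complex \<times> complex) set" where
  "secant_regular U f =
     {(x, y). x \<in> U \<and> y \<in> U \<and> \<not> is_pole f x \<and> \<not> is_pole f y \<and> f x \<noteq> f y}"

definition secant_formula :: "(complex \<Rightarrow> complex) \<Rightarrow> complex \<times> complex \<Rightarrow> complex \<times> complex" where
  "secant_formula f = (\<lambda>(x, y). ((f x * y - f y * x) / (f x - f y), x))"

text \<open>\<open>G\<close> is a holomorphic extension of the secant formula to the open set \<open>W\<close>.\<close>

definition secant_extension ::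
  "complex set \<Rightarrow> (complex \<Rightarrow> complex) \<Rightarrow> (complex \<times> complex) set \<Rightarrow>
     (complex \<times> complex \<Rightarrow> sphere \<times> sphere) \<Rightarrow> bool" where
  "secant_extension U f W G \<longleftrightarrow> W \<subseteq> U \<times> U \<and>
     sphere_holomorphic_on (\<lambda>p. fst (G p)) W \<and> sphere_holomorphic_on (\<lambda>p. snd (G p)) W \<and>
     (\<forall>p \<in> W \<inter> secant_regular U f. G p = emb (secant_formula f p))"

definition secant_dom :: "complex set \<Rightarrow> (complex \<Rightarrow> complex) \<Rightarrow> (complex \<times> complex) set" where
  "secant_dom U f = {p. \<exists>W G. secant_extension U f W G \<and> p \<in> W}"

text \<open>For connected open \<open>U\<close> and nonconstant \<open>f\<close> the set \<open>secant_regular U f\<close> is dense in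
  \<open>U \<times> U\<close>, so the value of an extension at a point of \<open>secant_dom U f\<close> does not depend on
  the choice of the extension.\<close>

definition secant_map ::
  "complex set \<Rightarrow> (complex \<Rightarrow> complex) \<Rightarrow> complex \<times> complex \<Rightarrow> sphere \<times> sphere" where
  "secant_map U f p = (THE q. \<exists>W G. secant_extension U f W G \<and> p \<in> W \<and> G p = q)"

text \<open>\<open>secant_iter U f n p\<close> is the \<open>n\<close>-th iterate where \<open>secant_iter_defined U f n p\<close> holds,
  and is meaningless elsewhere.\<close>

primrec secant_iter ::
  "complex set \<Rightarrow> (complex \<Rightarrow> complex) \<Rightarrow> nat \<Rightarrow> complex \<times> complex \<Rightarrow> sphere \<times> sphere" where
  "secant_iter U f 0 p = emb p"
| "secant_iter U f (Suc n) p = secant_map U f (aff (secant_iter U f n p))"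

text \<open>Note that \<open>secant_dom U f \<subseteq> U \<times> U\<close>.\<close>

definition secant_iter_defined ::
  "complex set \<Rightarrow> (complex \<Rightarrow> complex) \<Rightarrow> nat \<Rightarrow> complex \<times> complex \<Rightarrow> bool" where
  "secant_iter_defined U f n p \<longleftrightarrow> (\<forall>k<n. secant_iter U f k p \<in> emb ` secant_dom U f)"

definition basin :: "complex set \<Rightarrow> (complex \<Rightarrow> complex) \<Rightarrow> complex \<Rightarrow> (complex \<times> complex) set" where
  "basin U f z0 = {p \<in> U \<times> U.
     (\<forall>n. secant_iter_defined U f n p \<and> secant_iter U f n p \<in> emb ` (U \<times> U)) \<and>
     (\<lambda>n. aff (secant_iter U f n p)) \<longlonglongrightarrow> (z0, z0)}"

definition secant_preimage ::
  "complex set \<Rightarrow> (complex \<Rightarrow> complex) \<Rightarrow> nat \<Rightarrow> (complex \<times> complex) set \<Rightarrow> (complex \<times> complex) set" where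
  "secant_preimage U f n E =
     {p \<in> U \<times> U. secant_iter_defined U f n p \<and> secant_iter U f n p \<in> emb ` E}"

definition golden :: real where
  "golden = (1 + sqrt 5) / 2"

text \<open>The characterization of the Boettcher-type modulus, which determines \<open>H\<close> uniquely on
  the basin; values of \<open>H\<close> off the basin are irrelevant. Exponents are positive throughout,
  so \<open>0 powr a = 0\<close> agrees with the usual convention.\<close>

definition is_boettcher_modulus ::
  "complex set \<Rightarrow> (complex \<Rightarrow> complex) \<Rightarrow> complex \<Rightarrow> (complex \<times> complex \<Rightarrow> real) \<Rightarrow> bool" where
  "is_boettcher_modulus U f z0 H \<longleftrightarrow> continuous_on (basin U f z0) H \<and>
     (\<forall>(x, y) \<in> basin U f z0.
        (\<lambda>n. norm (fst (aff (secant_iter U f n (x, y))) - z0) powr (1 / golden ^ n))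
          \<longlonglongrightarrow> H (x, y) * norm (x - z0) powr (golden / sqrt 5) * norm (y - z0) powr (1 / sqrt 5))"

definition boettcher_h ::
  "complex \<Rightarrow> (complex \<times> complex \<Rightarrow> real) \<Rightarrow> complex \<times> complex \<Rightarrow> real" where
  "boettcher_h z0 H = (\<lambda>(x, y). max
     (H (x, y) * norm (x - z0) powr (golden / sqrt 5) * norm (y - z0) powr (1 / sqrt 5))
     (H (x, y) powr (1 / golden) * norm (x - z0) powr (1 / sqrt 5)
        * norm (y - z0) powr (inverse golden / sqrt 5)))"

text \<open>Norms on the complex vector space \<open>complex \<times> complex\<close>; nonnegativity follows.\<close>

definition is_norm_C2 :: "(complex \<times> complex \<Rightarrow> real) \<Rightarrow> bool" where
  "is_norm_C2 N \<longleftrightarrow> (\<forall>v. N v = 0 \<longleftrightarrow> v = 0) \<and>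
     (\<forall>c v. N (c * fst v, c * snd v) = norm c * N v) \<and>
     (\<forall>v w. N (v + w) \<le> N v + N w)"

end

theory Submission
  imports Defs
begin

text \<open>Near the simple root the secant map has the form
  \<open>(x, y) \<mapsto> (z0 + (x - z0) * (y - z0) * K (x, y), x)\<close> with \<open>K\<close> holomorphic, and \<open>K (z0, z0) \<noteq> 0\<close>
  because \<open>deriv (deriv f) z0 \<noteq> 0\<close>. Hence along an orbit in the basin the errors \<open>e n\<close> of the first coordinates
  eventually satisfy \<open>c * e (n + 1) * e n \<le> e (n + 2) \<le> C * e (n + 1) * e n\<close>. Comparison with sequences
  \<open>q powr (golden ^ n)\<close> shows that \<open>A = lim (e n powr (1 / golden ^ n))\<close> is less than \<open>1\<close>, and is
  positive unless the orbit hits the fixed point. As the second coordinate is the preceding first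
  coordinate, norms along the orbit are comparable to \<open>max (e n) (e (n - 1))\<close>, which yields the limit
  \<open>max A (A powr (1 / golden)) = A powr (1 / golden)\<close>.\<close>

section \<open>Divided differences\<close>

definition complex_differentiable2 :: "(complex \<times> complex \<Rightarrow> complex) \<Rightarrow> complex \<times> complex \<Rightarrow> bool" where
  "complex_differentiable2 g p \<longleftrightarrow> (\<exists>a b. (g has_derivative (\<lambda>v. a * fst v + b * snd v)) (at p))"

lemma norm_fst_le_norm: "norm (fst v) \<le> norm v"
  using norm_fst_le[of "fst v" "snd v"] unfolding prod.collapse .

lemma norm_snd_le_norm: "norm (snd v) \<le> norm v"
  using norm_snd_le[of "snd v" "fst v"] unfolding prod.collapse .

lemma complex_differentiable2_const: "complex_differentiable2 (\<lambda>_. c) p"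
  unfolding complex_differentiable2_def
  by (intro exI[of _ 0]) simp

lemma complex_differentiable2_of_fst:
  assumes "g field_differentiable at (fst p)"
  shows "complex_differentiable2 (\<lambda>q. g (fst q)) p"
proof -
  obtain d where d: "(g has_derivative (\<lambda>h. d * h)) (at (fst p))"
    using assms by (auto simp: field_differentiable_def has_field_derivative_def)
  have "((\<lambda>q. g (fst q)) has_derivative (\<lambda>v. d * fst v)) (at p)"
    using has_derivative_compose[OF has_derivative_fst[OF has_derivative_ident] d] by simp
  then show ?thesis
    unfolding complex_differentiable2_def by (intro exI[of _ d] exI[of _ 0]) simp
qed

lemma complex_differentiable2_of_snd:
  assumes "g field_differentiable at (snd p)"
  shows "complex_differentiable2 (\<lambda>q. g (snd q)) p"
proof -
  obtain d where d: "(g has_derivative (\<lambda>h. d * h)) (at (snd p))"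
    using assms by (auto simp: field_differentiable_def has_field_derivative_def)
  have "((\<lambda>q. g (snd q)) has_derivative (\<lambda>v. d * snd v)) (at p)"
    using has_derivative_compose[OF has_derivative_snd[OF has_derivative_ident] d] by simp
  then show ?thesis
    unfolding complex_differentiable2_def by (intro exI[of _ 0] exI[of _ d]) simp
qed

lemma complex_differentiable2_add:
  assumes "complex_differentiable2 g p" "complex_differentiable2 h p"
  shows "complex_differentiable2 (\<lambda>q. g q + h q) p"
proof -
  obtain a b c d where
    "(g has_derivative (\<lambda>v. a * fst v + b * snd v)) (at p)"
    "(h has_derivative (\<lambda>v. c * fst v + d * snd v)) (at p)"
    using assms unfolding complex_differentiable2_def by blast
  then have "((\<lambda>q. g q + h q) has_derivative (\<lambda>v. (a + c) * fst v + (b + d) * snd v)) (at p)"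
    by (auto intro!: derivative_eq_intros simp: algebra_simps)
  then show ?thesis unfolding complex_differentiable2_def by blast
qed

lemma complex_differentiable2_mult:
  assumes "complex_differentiable2 g p" "complex_differentiable2 h p"
  shows "complex_differentiable2 (\<lambda>q. g q * h q) p"
proof -
  obtain a b c d where
    "(g has_derivative (\<lambda>v. a * fst v + b * snd v)) (at p)"
    "(h has_derivative (\<lambda>v. c * fst v + d * snd v)) (at p)"
    using assms unfolding complex_differentiable2_def by blast
  then have "((\<lambda>q. g q * h q) has_derivative
      (\<lambda>v. (g p * c + a * h p) * fst v + (g p * d + b * h p) * snd v)) (at p)"
    by (auto intro!: derivative_eq_intros simp: algebra_simps)
  then show ?thesis unfolding complex_differentiable2_def by blast
qed

lemma complex_differentiable2_compose:
  assumes "complex_differentiable2 g p" "h field_differentiable at (g p)"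
  shows "complex_differentiable2 (\<lambda>q. h (g q)) p"
proof -
  obtain a b d where ab: "(g has_derivative (\<lambda>v. a * fst v + b * snd v)) (at p)"
    and d: "(h has_derivative (\<lambda>w. d * w)) (at (g p))"
    using assms by (auto simp: complex_differentiable2_def field_differentiable_def has_field_derivative_def)
  have "((\<lambda>q. h (g q)) has_derivative (\<lambda>v. (d * a) * fst v + (d * b) * snd v)) (at p)"
    using has_derivative_compose[OF ab d] by (simp add: algebra_simps)
  then show ?thesis unfolding complex_differentiable2_def by blast
qed

lemma complex_differentiable2_diff:
  assumes "complex_differentiable2 g p" "complex_differentiable2 h p"
  shows "complex_differentiable2 (\<lambda>q. g q - h q) p"
proof -
  have "complex_differentiable2 (\<lambda>q. g q + (- 1) * h q) p"
    by (intro complex_differentiable2_add complex_differentiable2_mult complex_differentiable2_const assms)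
  then show ?thesis by simp
qed

lemma complex_differentiable2_divide:
  assumes "complex_differentiable2 g p" "complex_differentiable2 h p" "h p \<noteq> 0"
  shows "complex_differentiable2 (\<lambda>q. g q / h q) p"
proof -
  have "inverse field_differentiable at (h p)"
    using assms(3) by (auto intro!: derivative_intros simp: field_differentiable_def)
  then show ?thesis
    unfolding divide_inverse
    by (intro complex_differentiable2_mult complex_differentiable2_compose[OF assms(2)] assms(1))
qed

lemma complex_differentiable2_transform:
  assumes "complex_differentiable2 g p" "open W" "p \<in> W" "\<And>q. q \<in> W \<Longrightarrow> g q = h q"
  shows "complex_differentiable2 h p"
  using assms has_derivative_transform_within_open[of g _ p UNIV W h]
  unfolding complex_differentiable2_def by (meson)

lemma complex_differentiable2_isCont:
  assumes "complex_differentiable2 g p"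
  shows "isCont g p"
  using assms has_derivative_continuous unfolding complex_differentiable2_def by blast

section \<open>Divided differences as functions of two complex variables\<close>

definition divided_difference :: "(complex \<Rightarrow> complex) \<Rightarrow> complex \<times> complex \<Rightarrow> complex" where
  "divided_difference g p =
     (if fst p = snd p then deriv g (fst p) else (g (fst p) - g (snd p)) / (fst p - snd p))"

text \<open>A bound for \<open>deriv g\<close> on a compact ball covers the diagonal; off it, the
  mean value inequality on the convex ball carries the same bound over to the quotients.\<close>

lemma divided_difference_bounded:
  assumes "open S" "g holomorphic_on S" "w \<in> S"
  obtains r M where "0 < r" "\<And>p. p \<in> ball w r \<times> ball w r \<Longrightarrow> norm (divided_difference g p) \<le> M"
proof -
  obtain r where r: "0 < r" "cball w r \<subseteq> S"
    using assms open_contains_cball by blast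
  have "continuous_on (cball w r) (deriv g)"
    using holomorphic_deriv[OF assms(2,1)] r holomorphic_on_imp_continuous_on
      holomorphic_on_subset by blast
  then have "bounded (deriv g ` cball w r)"
    by (intro compact_imp_bounded compact_continuous_image compact_cball)
  then obtain M where M: "\<And>x. x \<in> cball w r \<Longrightarrow> norm (deriv g x) \<le> M"
    unfolding bounded_iff by blast
  have "norm (divided_difference g p) \<le> M" if p: "p \<in> ball w r \<times> ball w r" for p
  proof (cases "fst p = snd p")
    case True
    with p M show ?thesis by (auto simp: divided_difference_def)
  next
    case False
    have "norm (g (fst p) - g (snd p)) \<le> M * norm (fst p - snd p)"
    proof (rule field_differentiable_bound[of "ball w r" g "deriv g"])
      fix z assume z: "z \<in> ball w r"
      then have "z \<in> S" using r by auto
      then show "(g has_field_derivative deriv g z) (at z within ball w r)"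
        using holomorphic_derivI[OF assms(2,1)] by blast
      show "norm (deriv g z) \<le> M" using z M by auto
    qed (use p in auto)
    with False show ?thesis
      by (simp add: divided_difference_def norm_divide divide_le_eq)
  qed
  with r show thesis using that by blast
qed

text \<open>The singularity at \<open>w\<close> is removable. The factorization holds for every
  \<open>x\<close>, also outside \<open>S\<close>, so it can later be substituted without membership
  conditions.\<close>

lemma holomorphic_difference_quotient:
  assumes "open S" "g holomorphic_on S" "w \<in> S"
  obtains h where "h holomorphic_on S" "\<And>x. g x = g w + (x - w) * h x" "h w = deriv g w"
proof -
  define h where "h z = (if z = w then deriv g w else (g z - g w) / (z - w))" for z
  have "h holomorphic_on S"
    using pole_lemma_open[OF assms(2,1), of w] by (simp add: h_def [abs_def])
  then show thesis
    by (rule that) (auto simp: h_def)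
qed

text \<open>Away from the diagonal this is a quotient with nonzero denominator; the content is joint
  differentiability at diagonal points.\<close>

lemma complex_differentiable2_divided_difference:
  assumes S: "open S" and g: "g holomorphic_on S" and p: "p \<in> S \<times> S"
  shows "complex_differentiable2 (divided_difference g) p"
proof (cases "fst p = snd p")
  case False
  have "complex_differentiable2 (\<lambda>q. (g (fst q) - g (snd q)) / (fst q - snd q)) p"
    using p False holomorphic_on_imp_differentiable_at[OF g S]
    by (intro complex_differentiable2_divide complex_differentiable2_diff
        complex_differentiable2_of_fst complex_differentiable2_of_snd) auto
  moreover have "open {q. fst q \<noteq> (snd q :: complex)}"
    by (intro open_Collect_neq continuous_intros)
  ultimately show ?thesis
    by (rule complex_differentiable2_transform) (use False in \<open>auto simp: divided_difference_def\<close>)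
next
  case True
  then obtain w where w: "p = (w, w)" "w \<in> S" using p by (cases p) auto
  \<comment> \<open>Writing \<open>g x = g w + g1 w * (x - w) + (x - w)\<^sup>2 * g2 x\<close>, the last term of the divided difference
    of \<open>g\<close> is quadratically small because divided differences of \<open>g2\<close> are bounded.\<close>
  obtain g1 where g1: "g1 holomorphic_on S" "\<And>x. g x = g w + (x - w) * g1 x"
    using holomorphic_difference_quotient[OF S g w(2)] by blast
  obtain g2 where g2: "g2 holomorphic_on S" "\<And>x. g1 x = g1 w + (x - w) * g2 x"
    using holomorphic_difference_quotient[OF S g1(1) w(2)] by blast
  have g_eq: "g x = g w + g1 w * (x - w) + (x - w)\<^sup>2 * g2 x" for x
    unfolding g1(2)[of x] g2(2)[of x] by (simp add: algebra_simps power2_eq_square)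
  obtain r M where r: "0 < r"
    and M: "\<And>q. q \<in> ball w r \<times> ball w r \<Longrightarrow> norm (divided_difference g2 q) \<le> M"
    using divided_difference_bounded[OF S g2(1) w(2)] by blast
  \<comment> \<open>With \<open>x = fst q\<close>, \<open>y = snd q\<close>: split
    \<open>(x - w)^2 * g2 x - (y - w)^2 * g2 y\<close> as
    \<open>(x - y) * (x + y - 2 * w) * g2 x + (y - w)^2 * (g2 x - g2 y)\<close> and divide by
    \<open>x - y\<close>. On the diagonal, differentiating \<open>g_eq\<close> gives the same
    formula.\<close>
  have expand: "g1 w + (fst q + snd q - 2 * w) * g2 (fst q) + (snd q - w)\<^sup>2 * divided_difference g2 q
      = divided_difference g q" if q: "q \<in> S \<times> S" for q
  proof (cases "fst q = snd q")
    case True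
    have "(g2 has_field_derivative deriv g2 (fst q)) (at (fst q))"
      using q holomorphic_derivI[OF g2(1) S] by auto
    then have "((\<lambda>x. g w + g1 w * (x - w) + (x - w)\<^sup>2 * g2 x) has_field_derivative
        g1 w + 2 * (fst q - w) * g2 (fst q) + (fst q - w)\<^sup>2 * deriv g2 (fst q)) (at (fst q))"
      by (auto intro!: derivative_eq_intros)
    then have "deriv g (fst q) = g1 w + 2 * (fst q - w) * g2 (fst q) + (fst q - w)\<^sup>2 * deriv g2 (fst q)"
      unfolding g_eq[abs_def, symmetric] by (rule DERIV_imp_deriv)
    with True show ?thesis by (simp add: divided_difference_def algebra_simps)
  next
    case False
    then show ?thesis
      by (simp add: divided_difference_def g_eq[of "fst q"] g_eq[of "snd q"])
         (simp add: field_simps power2_eq_square)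
  qed
  \<comment> \<open>Only boundedness of the divided difference of \<open>g2\<close> enters; assuming
    its differentiability at \<open>p\<close> would be circular.\<close>
  have "((\<lambda>q. (snd q - w)\<^sup>2 * divided_difference g2 q) has_derivative (\<lambda>_. 0)) (at p)"
  proof (rule has_derivativeI_sandwich[OF r])
    fix q assume q: "q \<in> UNIV" "q \<noteq> p" "dist q p < r"
    have le: "norm (fst q - w) \<le> norm (q - p)" "norm (snd q - w) \<le> norm (q - p)"
      using w norm_fst_le_norm[of "q - p"] norm_snd_le_norm[of "q - p"] by simp_all
    then have "q \<in> ball w r \<times> ball w r"
      using q(3) by (cases q) (auto simp: dist_norm norm_minus_commute)
    from M[OF this] have "norm ((snd q - w)\<^sup>2 * divided_difference g2 q) \<le> (norm (q - p))\<^sup>2 * M"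
      unfolding norm_mult norm_power by (intro mult_mono power_mono le) auto
    then show "norm ((snd q - w)\<^sup>2 * divided_difference g2 q
        - (snd p - w)\<^sup>2 * divided_difference g2 p - 0) / norm (q - p) \<le> norm (q - p) * M"
      using q(2) w by (simp add: divide_le_eq power2_eq_square mult_ac)
  next
    show "((\<lambda>q. norm (q - p) * M) \<longlongrightarrow> 0) (at p)"
      by (rule tendsto_eq_intros | simp)+
  qed simp
  then have "complex_differentiable2 (\<lambda>q. (snd q - w)\<^sup>2 * divided_difference g2 q) p"
    unfolding complex_differentiable2_def by (intro exI[of _ 0]) simp
  moreover have "complex_differentiable2 (\<lambda>q. g1 w + (fst q + snd q - 2 * w) * g2 (fst q)) p"
    using w holomorphic_on_imp_differentiable_at[OF g2(1) S]
    by (intro complex_differentiable2_add complex_differentiable2_mult complex_differentiable2_diff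
        complex_differentiable2_const complex_differentiable2_of_fst complex_differentiable2_of_snd) auto
  ultimately have "complex_differentiable2 (\<lambda>q. g1 w + (fst q + snd q - 2 * w) * g2 (fst q)
      + (snd q - w)\<^sup>2 * divided_difference g2 q) p"
    using complex_differentiable2_add by blast
  then show ?thesis
    by (rule complex_differentiable2_transform[where W = "S \<times> S"]) (use S p expand in \<open>auto intro: open_Times\<close>)
qed

section \<open>Uniqueness of the secant extension\<close>

text \<open>The sphere carries no topology here; this injection into Euclidean space serves to transport
  continuity and uniqueness of limits.\<close>

definition stereographic :: "sphere \<Rightarrow> complex \<times> real" where
  "stereographic q = (case q of Infty \<Rightarrow> (0, 1)
     | Fin z \<Rightarrow> (2 * z / of_real (1 + (norm z)\<^sup>2), 1 - 2 / (1 + (norm z)\<^sup>2)))"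

text \<open>Inversion conjugates the planar coordinate and reverses the height, so in the chart at
  \<open>Infty\<close> the formula stays regular at \<open>w = 0\<close>.\<close>

lemma stereographic_inv_chart:
  "stereographic (inv_chart w) = (2 * cnj w / of_real (1 + (norm w)\<^sup>2), 2 / (1 + (norm w)\<^sup>2) - 1)"
proof (cases "w = 0")
  case False
  have 1: "1 + (norm w)\<^sup>2 > 0" by (simp add: add_pos_nonneg)
  have 2: "complex_of_real (1 + (norm w)\<^sup>2) \<noteq> 0" using 1 by (metis of_real_eq_0_iff less_irrefl)
  have 3: "complex_of_real ((norm w)\<^sup>2) = w * cnj w" by (rule complex_norm_square)
  have "1 + (norm (1 / w))\<^sup>2 = (1 + (norm w)\<^sup>2) / (norm w)\<^sup>2"
    using False by (simp add: norm_divide field_simps)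
  moreover have "2 * (1 / w) / complex_of_real ((1 + (norm w)\<^sup>2) / (norm w)\<^sup>2)
      = 2 * cnj w / of_real (1 + (norm w)\<^sup>2)"
    using False 2 unfolding of_real_divide 3 by (simp add: field_simps)
  moreover have "1 - 2 / ((1 + (norm w)\<^sup>2) / (norm w)\<^sup>2) = 2 / (1 + (norm w)\<^sup>2) - 1"
    using False 1 by (simp add: field_simps)
  ultimately show ?thesis
    using False by (simp add: stereographic_def inv_chart_def)
qed (simp add: stereographic_def inv_chart_def)

text \<open>The height determines the norm of a finite point, and then the planar coordinate
  determines the point; only \<open>Infty\<close> has height 1.\<close>

lemma inj_stereographic: "inj stereographic"
proof (rule injI)
  fix p q assume eq: "stereographic p = stereographic q"
  have pos: "1 + (norm z)\<^sup>2 > 0" for z :: complex by (simp add: add_pos_nonneg)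
  show "p = q"
  proof (cases p; cases q)
    fix z w assume pq: "p = Fin z" "q = Fin w"
    have "2 / (1 + (norm z)\<^sup>2) = 2 / (1 + (norm w)\<^sup>2)"
      using eq pq by (simp add: stereographic_def)
    then have n: "1 + (norm z)\<^sup>2 = 1 + (norm w)\<^sup>2"
      using pos[of z] pos[of w] by (simp add: field_simps)
    have "2 * z / of_real (1 + (norm z)\<^sup>2) = 2 * w / of_real (1 + (norm w)\<^sup>2)"
      using eq unfolding pq stereographic_def sphere.case prod.inject by blast
    moreover have "complex_of_real (1 + (norm w)\<^sup>2) \<noteq> 0"
      using pos[of w] by (metis of_real_eq_0_iff less_irrefl)
    ultimately have "z = w" unfolding n by (simp only: divide_cancel_right) auto
    then show ?thesis using pq by simp
  qed (use eq pos in \<open>auto simp: stereographic_def field_simps\<close>, (metis pos less_irrefl)+)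
qed

lemma sphere_holomorphic_on_continuous:
  assumes "sphere_holomorphic_on G W"
  shows "continuous_on W (\<lambda>p. stereographic (G p))"
proof (rule continuous_at_imp_continuous_on, rule ballI)
  fix p assume "p \<in> W"
  then obtain V g where V: "p \<in> V" "V \<subseteq> W" "holomorphic2_on g V"
    and G: "(\<forall>q\<in>V. G q = Fin (g q)) \<or> (\<forall>q\<in>V. G q = inv_chart (g q))"
    using assms unfolding sphere_holomorphic_on_def by meson
  have oV: "open V" using V(3) by (simp add: holomorphic2_on_def)
  have cg: "continuous_on V g"
    using V(3) has_derivative_continuous unfolding holomorphic2_on_def
    by (metis continuous_at_imp_continuous_on)
  have nz: "complex_of_real (1 + (norm z)\<^sup>2) \<noteq> 0" "1 + (norm z)\<^sup>2 \<noteq> 0" for z :: complex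
    using add_pos_nonneg[of 1 "(norm z)\<^sup>2"] by (simp_all only: of_real_eq_0_iff) auto
  have "continuous_on V (\<lambda>q. stereographic (Fin (g q)))"
    unfolding stereographic_def sphere.case
    by (intro continuous_intros cg) (use nz in auto)
  moreover have "continuous_on V (\<lambda>q. stereographic (inv_chart (g q)))"
    unfolding stereographic_inv_chart
    by (intro continuous_intros cg) (use nz in auto)
  ultimately have "continuous_on V (\<lambda>q. stereographic (G q))"
    using G by (metis (no_types, lifting) continuous_on_cong)
  then show "isCont (\<lambda>p. stereographic (G p)) p"
    using oV V(1) by (simp add: continuous_on_eq_continuous_at)
qed

text \<open>Since \<open>W \<inter> W'\<close> is an open neighbourhood of \<open>p\<close>, points
  of \<open>D\<close> inside it still accumulate at \<open>p\<close>; along such a sequence both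
  maps have the same limit.\<close>

lemma sphere_holomorphic_on_eq_closure:
  assumes G: "sphere_holomorphic_on G W" "sphere_holomorphic_on G' W'"
    and p: "p \<in> W" "p \<in> W'" "p \<in> closure D"
    and eq: "\<And>q. q \<in> W \<inter> W' \<inter> D \<Longrightarrow> G q = G' q"
  shows "G p = G' p"
proof -
  have o: "open (W \<inter> W')" using G by (auto simp: sphere_holomorphic_on_def)
  have c: "continuous_on (W \<inter> W') (\<lambda>q. stereographic (G q))"
    "continuous_on (W \<inter> W') (\<lambda>q. stereographic (G' q))"
    using sphere_holomorphic_on_continuous[OF G(1)] sphere_holomorphic_on_continuous[OF G(2)]
    by (auto elim: continuous_on_subset)
  have cl: "p \<in> closure (W \<inter> W' \<inter> D)"
    using open_Int_closure_subset[OF o, of D] p by auto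
  then obtain s where s: "\<And>n. s n \<in> W \<inter> W' \<inter> D" "s \<longlonglongrightarrow> p"
    unfolding closure_sequential by blast
  have "(\<lambda>n. stereographic (G (s n))) \<longlonglongrightarrow> stereographic (G p)"
    "(\<lambda>n. stereographic (G' (s n))) \<longlonglongrightarrow> stereographic (G' p)"
    using c o p s by (auto simp: continuous_on_eq_continuous_at intro: isCont_tendsto_compose)
  moreover have "(\<lambda>n. stereographic (G (s n))) = (\<lambda>n. stereographic (G' (s n)))"
    using eq s(1) by auto
  ultimately have "stereographic (G p) = stereographic (G' p)"
    using LIMSEQ_unique by metis
  then show ?thesis using inj_stereographic by (simp add: inj_eq)
qed

text \<open>This resolves the definite description in \<open>secant_map\<close>: all extensions
  agree with the formula at regular points, and these accumulate at \<open>p\<close>.\<close>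

lemma secant_map_eq:
  assumes "secant_extension U f W G" "p \<in> W" "p \<in> closure (W \<inter> secant_regular U f)"
  shows "secant_map U f p = G p"
  unfolding secant_map_def
proof (rule the_equality)
  fix q assume "\<exists>W G. secant_extension U f W G \<and> p \<in> W \<and> G p = q"
  then obtain W' G' where G': "secant_extension U f W' G'" "p \<in> W'" "q = G' p" by blast
  have eq: "G' u = G u" if "u \<in> W' \<inter> W \<inter> (W \<inter> secant_regular U f)" for u
    using that assms(1) G'(1) by (auto simp: secant_extension_def)
  have "fst (G' p) = fst (G p)"
    using assms G'(1,2) eq
    by (intro sphere_holomorphic_on_eq_closure[of "\<lambda>p. fst (G' p)" W' "\<lambda>p. fst (G p)" W p
          "W \<inter> secant_regular U f"]) (auto simp: secant_extension_def)
  moreover have "snd (G' p) = snd (G p)"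
    using assms G'(1,2) eq
    by (intro sphere_holomorphic_on_eq_closure[of "\<lambda>p. snd (G' p)" W' "\<lambda>p. snd (G p)" W p
          "W \<inter> secant_regular U f"]) (auto simp: secant_extension_def)
  ultimately show "q = G p" using G'(3) by (simp add: prod_eq_iff)
qed (use assms in blast)

section \<open>Golden-ratio growth\<close>

lemma golden_gt_1: "golden > 1"
  unfolding golden_def by (simp add: real_less_rsqrt)

lemma golden_pos: "golden > 0"
  using golden_gt_1 by linarith

lemma golden_square: "golden\<^sup>2 = golden + 1"
  unfolding golden_def by (simp add: power2_eq_square field_simps)

lemma golden_power_Suc_Suc: "golden ^ Suc (Suc n) = golden ^ Suc n + golden ^ n"
proof -
  have "golden ^ Suc (Suc n) = golden ^ n * golden\<^sup>2" by (simp add: power2_eq_square)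
  then show ?thesis unfolding golden_square by (simp add: algebra_simps)
qed

text \<open>This is why multiplicative constants in the recurrence and in the comparison of norms
  leave no trace in the limits.\<close>

lemma powr_inverse_golden_power_tendsto_1:
  assumes "c > 0"
  shows "(\<lambda>n. c powr (1 / golden ^ n)) \<longlonglongrightarrow> 1"
proof -
  have "(\<lambda>n. c powr ((1 / golden) ^ n)) \<longlonglongrightarrow> c powr 0"
    using golden_gt_1 assms by (intro tendsto_powr tendsto_const LIMSEQ_power_zero) auto
  then show ?thesis using assms by (simp add: power_one_over)
qed

text \<open>The rescaled errors \<open>C * e n\<close> are eventually submultiplicative in the
  Fibonacci pattern. Once they are below 1/2 they stay below an exact solution \<open>q\<close> of
  \<open>q (k + 2) = q (k + 1) * q k\<close>, whose golden roots are constant and less than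
  1.\<close>

lemma golden_root_limit_less_1:
  fixes e :: "nat \<Rightarrow> real"
  assumes nonneg: "\<And>n. e n \<ge> 0" and C: "C > 0"
    and rec: "\<forall>\<^sub>F n in sequentially. e (Suc (Suc n)) \<le> C * e (Suc n) * e n"
    and e0: "e \<longlonglongrightarrow> 0" and lim: "(\<lambda>n. e n powr (1 / golden ^ n)) \<longlonglongrightarrow> A"
  shows "A < 1"
proof -
  have "(\<lambda>n. C * e n) \<longlonglongrightarrow> 0" using tendsto_mult_right_zero[OF e0] by simp
  then have "\<forall>\<^sub>F n in sequentially. C * e n < 1 / 2" by (rule order_tendstoD) simp
  with rec have "\<forall>\<^sub>F n in sequentially. C * e n < 1 / 2 \<and> e (Suc (Suc n)) \<le> C * e (Suc n) * e n"
    by eventually_elim simp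
  then obtain m where m: "\<And>n. n \<ge> m \<Longrightarrow> C * e n < 1 / 2"
    "\<And>n. n \<ge> m \<Longrightarrow> e (Suc (Suc n)) \<le> C * e (Suc n) * e n"
    unfolding eventually_sequentially by blast
  \<comment> \<open>Dividing the exponent by \<open>golden\<close> makes both \<open>q 0\<close> and \<open>q 1\<close> at least \<open>1 / 2\<close>.\<close>
  define q where "q k = (1 / 2 :: real) powr (golden ^ k / golden)" for k
  have q_rec: "q (Suc (Suc k)) = q (Suc k) * q k" for k
    unfolding q_def powr_add[symmetric] golden_power_Suc_Suc by (simp add: add_divide_distrib)
  have bound: "C * e (m + k) \<le> q k \<and> C * e (m + Suc k) \<le> q (Suc k)" for k
  proof (induction k)
    case 0
    have "(1 / 2 :: real) powr 1 \<le> (1 / 2) powr (1 / golden)"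
      by (intro powr_mono') (use golden_gt_1 in auto)
    then show ?case using m(1)[of m] m(1)[of "Suc m"] golden_pos by (simp add: q_def)
  next
    case (Suc k)
    have "C * e (m + Suc (Suc k)) \<le> C * (C * e (m + Suc k) * e (m + k))"
      using m(2)[of "m + k"] C by (intro mult_left_mono) auto
    also have "\<dots> = (C * e (m + Suc k)) * (C * e (m + k))" by simp
    also have "\<dots> \<le> q (Suc k) * q k"
      using Suc C nonneg by (intro mult_mono) (auto simp: q_def)
    finally show ?case using Suc q_rec by simp
  qed
  \<comment> \<open>The exponent collects the starting index \<open>m\<close> and the extra division
    by \<open>golden\<close> in \<open>q\<close>.\<close>
  define B where "B = (1 / 2 :: real) powr (1 / golden ^ Suc m)"
  have "e (k + m) powr (1 / golden ^ (k + m)) \<le> (1 / C) powr (1 / golden ^ (k + m)) * B" for k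
  proof -
    have "e (k + m) \<le> (1 / C) * q k"
      using bound[of k] C by (simp add: field_simps)
    then have "e (k + m) powr (1 / golden ^ (k + m)) \<le> ((1 / C) * q k) powr (1 / golden ^ (k + m))"
      using golden_pos nonneg by (intro powr_mono2) auto
    also have "\<dots> = (1 / C) powr (1 / golden ^ (k + m)) * q k powr (1 / golden ^ (k + m))"
      using C by (intro powr_mult)
    also have "q k powr (1 / golden ^ (k + m)) = B"
      using golden_pos by (simp add: q_def B_def powr_powr power_add)
    finally show ?thesis .
  qed
  moreover have "(\<lambda>k. (1 / C) powr (1 / golden ^ (k + m)) * B) \<longlonglongrightarrow> 1 * B"
    using C by (intro tendsto_mult tendsto_const LIMSEQ_ignore_initial_segment[OF powr_inverse_golden_power_tendsto_1]) auto
  ultimately have "A \<le> B"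
    using LIMSEQ_le[OF LIMSEQ_ignore_initial_segment[OF lim, of m]] by fastforce
  also have "B < (1 / 2) powr 0"
    unfolding B_def using golden_pos by (intro powr_less_mono') auto
  finally show ?thesis by simp
qed

text \<open>The mirror image of the upper estimate: \<open>c * e n\<close> dominates an exact
  solution of the Fibonacci product recurrence whose golden roots are a positive constant.\<close>

lemma golden_root_limit_positive:
  fixes e :: "nat \<Rightarrow> real"
  assumes pos: "\<forall>\<^sub>F n in sequentially. e n > 0" and c: "c > 0"
    and rec: "\<forall>\<^sub>F n in sequentially. e (Suc (Suc n)) \<ge> c * e (Suc n) * e n"
    and lim: "(\<lambda>n. e n powr (1 / golden ^ n)) \<longlonglongrightarrow> A"
  shows "A > 0"
proof -
  obtain m where m: "\<And>n. n \<ge> m \<Longrightarrow> e n > 0"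
    "\<And>n. n \<ge> m \<Longrightarrow> e (Suc (Suc n)) \<ge> c * e (Suc n) * e n"
    using eventually_conj[OF pos rec] unfolding eventually_sequentially by blast
  \<comment> \<open>The cap 1/2 gives \<open>b powr golden \<le> b\<close>, so that
    \<open>q 1\<close> as well as \<open>q 0\<close> lies below its starting value.\<close>
  define b where "b = min (1 / 2) (min (c * e m) (c * e (Suc m)))"
  have b: "0 < b" "b \<le> 1" "b \<le> c * e m" "b \<le> c * e (Suc m)"
    using c m(1) by (auto simp: b_def)
  define q where "q k = b powr (golden ^ k)" for k
  have q_rec: "q (Suc (Suc k)) = q (Suc k) * q k" for k
    unfolding q_def powr_add[symmetric] golden_power_Suc_Suc by simp
  have bound: "q k \<le> c * e (m + k) \<and> q (Suc k) \<le> c * e (m + Suc k)" for k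
  proof (induction k)
    case 0
    have "b powr golden \<le> b powr 1"
      using b golden_gt_1 by (intro powr_mono') auto
    then show ?case using b by (simp add: q_def)
  next
    case (Suc k)
    have "q (Suc k) * q k \<le> (c * e (m + Suc k)) * (c * e (m + k))"
      using Suc m(1)[of "m + Suc k"] c by (intro mult_mono) (auto simp: q_def)
    also have "\<dots> = c * (c * e (m + Suc k) * e (m + k))" by simp
    also have "\<dots> \<le> c * e (m + Suc (Suc k))"
      using m(2)[of "m + k"] c by (intro mult_left_mono) auto
    finally show ?case using Suc q_rec by simp
  qed
  define B where "B = b powr (1 / golden ^ m)"
  have "(1 / c) powr (1 / golden ^ (k + m)) * B \<le> e (k + m) powr (1 / golden ^ (k + m))" for k
  proof -
    have "(1 / c) * q k \<le> e (k + m)"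
      using bound[of k] c by (simp add: field_simps)
    then have "((1 / c) * q k) powr (1 / golden ^ (k + m)) \<le> e (k + m) powr (1 / golden ^ (k + m))"
      using golden_pos c by (intro powr_mono2) (auto simp: q_def)
    moreover have "((1 / c) * q k) powr (1 / golden ^ (k + m))
        = (1 / c) powr (1 / golden ^ (k + m)) * q k powr (1 / golden ^ (k + m))"
      using c by (intro powr_mult)
    moreover have "q k powr (1 / golden ^ (k + m)) = B"
      using golden_pos by (simp add: q_def B_def powr_powr power_add)
    ultimately show ?thesis by simp
  qed
  moreover have "(\<lambda>k. (1 / c) powr (1 / golden ^ (k + m)) * B) \<longlonglongrightarrow> 1 * B"
    using c by (intro tendsto_mult tendsto_const LIMSEQ_ignore_initial_segment[OF powr_inverse_golden_power_tendsto_1]) auto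
  ultimately have "B \<le> A"
    using LIMSEQ_le[OF _ LIMSEQ_ignore_initial_segment[OF lim, of m]] by fastforce
  moreover have "B > 0" unfolding B_def using b by simp
  ultimately show ?thesis by simp
qed

section \<open>Equivalence of norms on the complex plane squared\<close>

text \<open>Expanding in the standard basis gives the upper bound and makes \<open>N\<close>
  Lipschitz. Hence \<open>N\<close> attains a positive minimum on the compact unit sphere, and
  homogeneity turns it into the lower bound.\<close>

lemma norm_C2_equivalent_max:
  assumes N: "is_norm_C2 N"
  obtains c C where "0 < c" "0 < C"
    "\<forall>v. c * max (norm (fst v)) (norm (snd v)) \<le> N v"
    "\<forall>v. N v \<le> C * max (norm (fst v)) (norm (snd v))"
proof -
  have zero: "N v = 0 \<longleftrightarrow> v = 0" for v using N unfolding is_norm_C2_def by blast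
  have scale: "N (s * fst v, s * snd v) = norm s * N v" for s v using N unfolding is_norm_C2_def by blast
  have tri: "N (v + w) \<le> N v + N w" for v w using N unfolding is_norm_C2_def by blast
  have minus: "N (- v) = N v" for v using scale[of "-1" v] by (simp add: uminus_prod_def)
  have nonneg: "N v \<ge> 0" for v using tri[of v "- v"] zero[of 0] minus by simp
  define C where "C = N (1, 0) + N (0, 1)"
  have "N (1, 0) \<noteq> 0" using zero by (simp add: zero_prod_def)
  then have C: "C > 0" unfolding C_def using nonneg[of "(1, 0)"] nonneg[of "(0, 1)"] by linarith
  have upper: "N v \<le> C * max (norm (fst v)) (norm (snd v))" for v
  proof -
    have "N v = N ((fst v * 1, fst v * 0) + (snd v * 0, snd v * 1))" by simp
    also have "\<dots> \<le> norm (fst v) * N (1, 0) + norm (snd v) * N (0, 1)"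
      using tri scale[of "fst v" "(1, 0)"] scale[of "snd v" "(0, 1)"] by (metis fst_conv snd_conv)
    also have "\<dots> \<le> max (norm (fst v)) (norm (snd v)) * N (1, 0) + max (norm (fst v)) (norm (snd v)) * N (0, 1)"
      by (intro add_mono mult_right_mono nonneg) auto
    finally show ?thesis by (simp add: C_def algebra_simps)
  qed
  have lip: "\<bar>N v - N w\<bar> \<le> C * norm (v - w)" for v w
  proof -
    have "\<bar>N v - N w\<bar> \<le> N (v - w)"
      using tri[of "v - w" w] tri[of "w - v" v] minus[of "v - w"] by simp
    also have "\<dots> \<le> C * max (norm (fst (v - w))) (norm (snd (v - w)))" by (rule upper)
    also have "\<dots> \<le> C * norm (v - w)"
      using C norm_fst_le_norm[of "v - w"] norm_snd_le_norm[of "v - w"]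
      by (intro mult_left_mono) auto
    finally show ?thesis .
  qed
  have cont: "continuous_on (sphere 0 1) N"
    by (rule lipschitz_on_continuous_on[where L = C], rule lipschitz_onI)
       (use lip C in \<open>auto simp: dist_norm\<close>)
  have "norm (1 :: complex, 0 :: complex) = 1" by (simp add: norm_Pair)
  then have "sphere (0 :: complex \<times> complex) 1 \<noteq> {}"
    by (metis dist_0_norm empty_iff mem_sphere)
  then obtain u where u: "u \<in> sphere 0 1" "\<And>v. v \<in> sphere 0 1 \<Longrightarrow> N u \<le> N v"
    using continuous_attains_inf[OF compact_sphere _ cont] by blast
  have "N u > 0" using u(1) zero[of u] nonneg[of u] by (auto simp: less_le)
  moreover have "N u * max (norm (fst v)) (norm (snd v)) \<le> N v" for v
  proof (cases "v = 0")
    case False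
    let ?s = "complex_of_real (1 / norm v)"
    have "(?s * fst v, ?s * snd v) = (1 / norm v) *\<^sub>R v"
      by (simp add: prod_eq_iff scaleR_conv_of_real)
    then have "(?s * fst v, ?s * snd v) \<in> sphere 0 1" using False by simp
    from u(2)[OF this] have "N u \<le> 1 / norm v * N v" unfolding scale norm_of_real by simp
    then have "N u * norm v \<le> N v" using False by (simp add: field_simps)
    moreover have "N u * max (norm (fst v)) (norm (snd v)) \<le> N u * norm v"
      using nonneg norm_fst_le_norm[of v] norm_snd_le_norm[of v]
      by (intro mult_left_mono) auto
    ultimately show ?thesis by linarith
  qed (use zero[of 0] in simp)
  ultimately show thesis using that C upper by blast
qed

section \<open>Dynamics near the root\<close>

lemma aff_emb [simp]: "aff (emb p) = p"
  by (simp add: aff_def emb_def)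

locale secant_root =
  fixes U :: "complex set" and f :: "complex \<Rightarrow> complex" and z0 :: complex
  assumes open_U: "open U" and z0_in_U: "z0 \<in> U" and analytic: "f analytic_on {z0}"
    and root: "f z0 = 0" and deriv_nonzero: "deriv f z0 \<noteq> 0"
    and deriv2_nonzero: "deriv (deriv f) z0 \<noteq> 0"
begin

text \<open>The holomorphic factor \<open>K\<close> appears only through a number \<open>k\<close>
  with uniform two-sided bounds, which is all that the estimates along orbits use.\<close>

lemma secant_map_near_root:
  obtains r c C where "0 < r" "0 < c" "0 < C"
    "\<And>x y. x \<in> ball z0 r \<Longrightarrow> y \<in> ball z0 r \<Longrightarrow> (x, y) \<in> secant_dom U f \<and>
      (\<exists>k. c \<le> norm k \<and> norm k \<le> C \<and>
        secant_map U f (x, y) = emb (z0 + (x - z0) * (y - z0) * k, x))"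
proof -
  obtain S0 where S0: "open S0" "z0 \<in> S0" "f holomorphic_on S0"
    using analytic by (auto simp: analytic_at)
  define S where "S = S0 \<inter> U"
  have S: "open S" "z0 \<in> S" "S \<subseteq> U" "f holomorphic_on S"
    using S0 open_U z0_in_U by (auto simp: S_def intro: holomorphic_on_subset)
  obtain g where g: "g holomorphic_on S" "\<And>x. f x = (x - z0) * g x"
    using holomorphic_difference_quotient[OF S(1,4,2)] unfolding root by auto
  have g_deriv: "(g has_field_derivative deriv g x) (at x)" if "x \<in> S" for x
    using holomorphic_derivI[OF g(1) S(1) that] .
  have f_deriv: "deriv f x = g x + (x - z0) * deriv g x" if "x \<in> S" for x
    unfolding g(2)[abs_def] by (rule DERIV_imp_deriv) (auto intro!: derivative_eq_intros g_deriv that)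
  \<comment> \<open>Differentiating \<open>f x = (x - z0) * g x\<close> twice at \<open>z0\<close>
    gives \<open>2 * deriv g z0\<close>, so the assumption on the second derivative becomes
    \<open>deriv g z0 \<noteq> 0\<close>.\<close>
  have "((\<lambda>x. g x + (x - z0) * deriv g x) has_field_derivative 2 * deriv g z0) (at z0)"
    using holomorphic_derivI[OF holomorphic_deriv[OF g(1) S(1)] S(1,2)] S(2)
    by (auto intro!: derivative_eq_intros g_deriv)
  then have "(deriv f has_field_derivative 2 * deriv g z0) (at z0)"
    by (rule has_field_derivative_transform_within_open[OF _ S(1,2)]) (simp add: f_deriv)
  then have dg: "deriv g z0 \<noteq> 0"
    using deriv2_nonzero DERIV_imp_deriv by fastforce
  \<comment> \<open>Since \<open>f x = (x - z0) * g x\<close>, the numerator \<open>f x * (y - z0) - f y * (x - z0)\<close> equals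
    \<open>(x - z0) * (y - z0) * (g x - g y)\<close>; so \<open>K\<close> is the quotient of the divided differences of
    \<open>g\<close> and \<open>f\<close>, which has the nonzero value \<open>deriv (deriv f) z0 / (2 * deriv f z0)\<close> at \<open>(z0, z0)\<close>.\<close>
  define D where "D = divided_difference f"
  define K where "K = (\<lambda>p. divided_difference g p / D p)"
  have D_diff: "complex_differentiable2 D p" if "p \<in> S \<times> S" for p
    unfolding D_def using complex_differentiable2_divided_difference[OF S(1,4) that] .
  have K_diff: "complex_differentiable2 K p" if "p \<in> S \<times> S" "D p \<noteq> 0" for p
    unfolding K_def
    by (intro complex_differentiable2_divide complex_differentiable2_divided_difference[OF S(1) g(1)] D_diff that)
  have p0: "(z0, z0) \<in> S \<times> S" using S by simp
  have D0: "D (z0, z0) \<noteq> 0" using deriv_nonzero by (simp add: D_def divided_difference_def)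
  have K0: "K (z0, z0) \<noteq> 0" using dg D0 by (simp add: K_def divided_difference_def)
  have D_lim: "(D \<longlongrightarrow> D (z0, z0)) (nhds (z0, z0))"
    and K_lim: "(K \<longlongrightarrow> K (z0, z0)) (nhds (z0, z0))"
    using complex_differentiable2_isCont[OF D_diff[OF p0]]
      complex_differentiable2_isCont[OF K_diff[OF p0 D0]]
    by (simp_all add: isCont_def tendsto_nhds_iff)
  have "\<forall>\<^sub>F p in nhds (z0, z0). D p \<noteq> 0"
    using tendsto_imp_eventually_ne[OF D_lim D0] .
  \<comment> \<open>Half and twice the nonzero value at the root leave strict room, so by continuity
    they bound \<open>K\<close> from both sides nearby.\<close>
  moreover have "\<forall>\<^sub>F p in nhds (z0, z0). norm (K (z0, z0)) / 2 < norm (K p)"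
    using K0 by (intro order_tendstoD(1)[OF tendsto_norm[OF K_lim]]) simp
  moreover have "\<forall>\<^sub>F p in nhds (z0, z0). norm (K p) < 2 * norm (K (z0, z0))"
    using K0 by (intro order_tendstoD(2)[OF tendsto_norm[OF K_lim]]) simp
  moreover have "\<forall>\<^sub>F p in nhds (z0, z0). p \<in> S \<times> S"
    using eventually_nhds_in_open[OF open_Times[OF S(1,1)] p0] .
  ultimately have "\<forall>\<^sub>F p in nhds (z0, z0). D p \<noteq> 0 \<and> norm (K (z0, z0)) / 2 \<le> norm (K p) \<and>
      norm (K p) \<le> 2 * norm (K (z0, z0)) \<and> p \<in> S \<times> S"
    by eventually_elim auto
  then obtain W0 where W0: "open W0" "(z0, z0) \<in> W0"
    "\<And>p. p \<in> W0 \<Longrightarrow> D p \<noteq> 0 \<and> norm (K (z0, z0)) / 2 \<le> norm (K p) \<and>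
      norm (K p) \<le> 2 * norm (K (z0, z0)) \<and> p \<in> S \<times> S"
    unfolding eventually_nhds by blast
  obtain A B where AB: "open A" "open B" "z0 \<in> A \<inter> B" "A \<times> B \<subseteq> W0"
    using open_prod_elim[OF W0(1,2)] by (metis IntI mem_Sigma_iff)
  then obtain r where r: "0 < r" "ball z0 r \<subseteq> A \<inter> B"
    by (meson open_Int open_contains_ball)
  define W where "W = ball z0 r \<times> ball z0 r"
  have W: "D p \<noteq> 0" "norm (K (z0, z0)) / 2 \<le> norm (K p)" "norm (K p) \<le> 2 * norm (K (z0, z0))"
    "p \<in> S \<times> S" if "p \<in> W" for p
    using W0(3)[of p] that r(2) AB(4) by (auto simp: W_def)
  have oW: "open W" by (auto simp: W_def intro: open_Times)
  define F where "F p = z0 + (fst p - z0) * (snd p - z0) * K p" for p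
  define G where "G p = emb (F p, fst p)" for p
  have cd_ident: "(\<lambda>x. x) field_differentiable at (x::complex)" for x
    by (auto intro!: derivative_intros simp: field_differentiable_def)
  have cd_shift: "(\<lambda>x. x - z0) field_differentiable at x" for x
    using DERIV_diff[OF DERIV_ident DERIV_const] unfolding field_differentiable_def by blast
  have F_hol: "holomorphic2_on F W"
    unfolding holomorphic2_on_def complex_differentiable2_def[symmetric] F_def
    using oW W cd_ident cd_shift
    by (auto intro!: complex_differentiable2_add complex_differentiable2_mult complex_differentiable2_diff
        complex_differentiable2_const complex_differentiable2_of_fst complex_differentiable2_of_snd K_diff)
  have fst_hol: "holomorphic2_on fst W"
    unfolding holomorphic2_on_def complex_differentiable2_def[symmetric]
    using oW complex_differentiable2_of_fst[OF cd_ident] by simp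
  \<comment> \<open>A nonzero divided difference of \<open>f\<close> separates the values at
    distinct points.\<close>
  have regular: "p \<in> secant_regular U f" if "p \<in> W" "fst p \<noteq> snd p" for p
  proof -
    have "f (fst p) \<noteq> f (snd p)"
      using W(1)[OF that(1)] that(2) by (auto simp: D_def divided_difference_def)
    then show ?thesis
      using W(4)[OF that(1)] S not_is_pole_holomorphic[OF S(1) _ S(4)]
      by (cases p) (auto simp: secant_regular_def)
  qed
  have ext: "secant_extension U f W G"
    unfolding secant_extension_def
  proof (intro conjI ballI)
    show "W \<subseteq> U \<times> U" using W(4) S(3) by blast
    show "sphere_holomorphic_on (\<lambda>p. fst (G p)) W"
      using oW F_hol by (auto simp: sphere_holomorphic_on_def G_def emb_def)
    show "sphere_holomorphic_on (\<lambda>p. snd (G p)) W"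
      using oW fst_hol by (auto simp: sphere_holomorphic_on_def G_def emb_def)
    fix p assume p: "p \<in> W \<inter> secant_regular U f"
    then have ne: "f (fst p) - f (snd p) \<noteq> 0" "fst p \<noteq> snd p"
      by (auto simp: secant_regular_def)
    have K_eq: "K p = (g (fst p) - g (snd p)) / (f (fst p) - f (snd p))"
      using ne by (simp add: K_def D_def divided_difference_def)
    have "F p * (f (fst p) - f (snd p))
        = z0 * (f (fst p) - f (snd p)) + (fst p - z0) * (snd p - z0) * (g (fst p) - g (snd p))"
      using ne by (simp add: F_def K_eq distrib_right)
    also have "\<dots> = f (fst p) * snd p - f (snd p) * fst p"
      by (simp add: g(2) algebra_simps)
    finally have "F p = (f (fst p) * snd p - f (snd p) * fst p) / (f (fst p) - f (snd p))"
      using ne by (simp add: eq_divide_eq)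
    then show "G p = emb (secant_formula f p)"
      by (simp add: G_def secant_formula_def case_prod_unfold)
  qed
  have dense: "p \<in> closure (W \<inter> secant_regular U f)" if p: "p \<in> W" for p
  proof (cases "fst p = snd p")
    case False
    then have "p \<in> W \<inter> secant_regular U f" using regular[OF p] p by simp
    then show ?thesis by (rule closure_subset[THEN subsetD])
  next
    case True
    then obtain x where x: "p = (x, x)" by (cases p) auto
    have xr: "dist z0 x < r" using p x by (auto simp: W_def)
    show ?thesis
      unfolding closure_approachable
    proof (intro allI impI)
      fix e :: real assume e: "e > 0"
      \<comment> \<open>Moving one coordinate by \<open>t\<close> leaves the diagonal while staying
        inside \<open>W\<close> and within distance \<open>e\<close>.\<close>
      define t where "t = min e (r - dist z0 x) / 2"
      have t: "0 < t" "t < e" "t < r - dist z0 x" using e xr by (auto simp: t_def min_def)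
      have d: "dist x (x + of_real t) = t" using t by (simp add: dist_norm)
      have "dist z0 (x + of_real t) < r"
        using dist_triangle[of z0 "x + of_real t" x] t d by linarith
      then have q: "(x, x + of_real t) \<in> W" using xr by (simp add: W_def)
      moreover have "dist (x, x + of_real t) p < e"
        using t d x by (simp add: dist_Pair_Pair dist_commute)
      ultimately show "\<exists>q\<in>W \<inter> secant_regular U f. dist q p < e"
        using regular[OF q] t(1) by auto
    qed
  qed
  show thesis
  proof (rule that[of r "norm (K (z0, z0)) / 2" "2 * norm (K (z0, z0))"])
    fix x y assume "x \<in> ball z0 r" "y \<in> ball z0 r"
    then have p: "(x, y) \<in> W" by (simp add: W_def)
    then have "secant_map U f (x, y) = emb (z0 + (x - z0) * (y - z0) * K (x, y), x)"
      using secant_map_eq[OF ext p dense[OF p]] by (simp add: G_def F_def)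
    then show "(x, y) \<in> secant_dom U f \<and> (\<exists>k. norm (K (z0, z0)) / 2 \<le> norm k \<and>
        norm k \<le> 2 * norm (K (z0, z0)) \<and>
        secant_map U f (x, y) = emb (z0 + (x - z0) * (y - z0) * k, x))"
      using W[OF p] p ext by (auto simp: secant_dom_def)
  qed (use r K0 in auto)
qed

lemma secant_map_root: "secant_map U f (z0, z0) = emb (z0, z0)" "(z0, z0) \<in> secant_dom U f"
proof -
  obtain r where "0 < r" "\<And>x y. x \<in> ball z0 r \<Longrightarrow> y \<in> ball z0 r \<Longrightarrow>
      (x, y) \<in> secant_dom U f \<and> (\<exists>k. secant_map U f (x, y) = emb (z0 + (x - z0) * (y - z0) * k, x))"
    using secant_map_near_root by metis
  from this(2)[of z0 z0] \<open>0 < r\<close>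
  show "secant_map U f (z0, z0) = emb (z0, z0)" "(z0, z0) \<in> secant_dom U f" by auto
qed

section \<open>Orbits in the basin\<close>

abbreviation orbit :: "complex \<times> complex \<Rightarrow> nat \<Rightarrow> complex \<times> complex" where
  "orbit p n \<equiv> aff (secant_iter U f n p)"

abbreviation err :: "complex \<times> complex \<Rightarrow> nat \<Rightarrow> real" where
  "err p n \<equiv> norm (fst (orbit p n) - z0)"

text \<open>Membership in the basin keeps every iterate finite, which is what makes
  \<open>aff\<close> faithful along the orbit.\<close>

lemma emb_aff_secant_iter:
  assumes "p \<in> basin U f z0"
  shows "emb (orbit p n) = secant_iter U f n p"
  using assms by (auto simp: basin_def dest!: spec[of _ n])

lemma orbit_tendsto: "p \<in> basin U f z0 \<Longrightarrow> orbit p \<longlonglongrightarrow> (z0, z0)"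
  by (simp add: basin_def)

lemma orbit_step:
  assumes p: "p \<in> basin U f z0"
  obtains c C where "0 < c" "0 < C"
    "\<forall>\<^sub>F n in sequentially. \<exists>k. c \<le> norm k \<and> norm k \<le> C \<and>
      orbit p (Suc n) = (z0 + (fst (orbit p n) - z0) * (snd (orbit p n) - z0) * k, fst (orbit p n))"
proof -
  obtain r c C where r: "0 < r" "0 < c" "0 < C"
    "\<And>x y. x \<in> ball z0 r \<Longrightarrow> y \<in> ball z0 r \<Longrightarrow> (x, y) \<in> secant_dom U f \<and>
      (\<exists>k. c \<le> norm k \<and> norm k \<le> C \<and>
        secant_map U f (x, y) = emb (z0 + (x - z0) * (y - z0) * k, x))"
    using secant_map_near_root by blast
  have "\<forall>\<^sub>F n in sequentially. orbit p n \<in> ball z0 r \<times> ball z0 r"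
    using r(1) by (intro topological_tendstoD[OF orbit_tendsto[OF p]] open_Times) auto
  then have "\<forall>\<^sub>F n in sequentially. \<exists>k. c \<le> norm k \<and> norm k \<le> C \<and>
      orbit p (Suc n) = (z0 + (fst (orbit p n) - z0) * (snd (orbit p n) - z0) * k, fst (orbit p n))"
  proof eventually_elim
    case (elim n)
    then obtain k where k: "c \<le> norm k" "norm k \<le> C"
      "secant_map U f (orbit p n) = emb (z0 + (fst (orbit p n) - z0) * (snd (orbit p n) - z0) * k, fst (orbit p n))"
      using r(4)[of "fst (orbit p n)" "snd (orbit p n)"] by (auto simp: mem_Times_iff)
    then show ?case by auto
  qed
  with r show thesis using that by blast
qed

text \<open>Stated only eventually, since the explicit form of the map is established only near the
  root.\<close>

lemma eventually_snd_orbit: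
  assumes "p \<in> basin U f z0"
  shows "\<forall>\<^sub>F n in sequentially. snd (orbit p (Suc n)) = fst (orbit p n)"
proof -
  obtain c C where ev: "\<forall>\<^sub>F n in sequentially. \<exists>k. c \<le> norm k \<and> norm k \<le> C \<and>
      orbit p (Suc n) = (z0 + (fst (orbit p n) - z0) * (snd (orbit p n) - z0) * k, fst (orbit p n))"
    using orbit_step[OF assms] by blast
  then show ?thesis by eventually_elim (metis snd_conv)
qed

text \<open>The explicit step at index \<open>n + 1\<close>, with its second coordinate replaced by
  the first coordinate at index \<open>n\<close>, reduces the planar map to a scalar recurrence of
  order two.\<close>

lemma err_recurrence:
  assumes p: "p \<in> basin U f z0"
  obtains c C where "0 < c" "0 < C"
    "\<forall>\<^sub>F n in sequentially. c * err p (Suc n) * err p n \<le> err p (Suc (Suc n))"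
    "\<forall>\<^sub>F n in sequentially. err p (Suc (Suc n)) \<le> C * err p (Suc n) * err p n"
proof -
  obtain c C where c: "0 < c" "0 < C"
    and ev: "\<forall>\<^sub>F n in sequentially. \<exists>k. c \<le> norm k \<and> norm k \<le> C \<and>
      orbit p (Suc n) = (z0 + (fst (orbit p n) - z0) * (snd (orbit p n) - z0) * k, fst (orbit p n))"
    using orbit_step[OF p] by blast
  have ev': "\<forall>\<^sub>F n in sequentially. \<exists>k. c \<le> norm k \<and> norm k \<le> C \<and>
      orbit p (Suc (Suc n)) = (z0 + (fst (orbit p (Suc n)) - z0) * (snd (orbit p (Suc n)) - z0) * k,
        fst (orbit p (Suc n)))"
    using eventually_compose_filterlim[OF ev filterlim_Suc] .
  have "\<forall>\<^sub>F n in sequentially. c * err p (Suc n) * err p n \<le> err p (Suc (Suc n)) \<and>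
      err p (Suc (Suc n)) \<le> C * err p (Suc n) * err p n"
    using ev' eventually_snd_orbit[OF p]
  proof eventually_elim
    case (elim n)
    then obtain k where k: "c \<le> norm k" "norm k \<le> C"
      "orbit p (Suc (Suc n)) = (z0 + (fst (orbit p (Suc n)) - z0) * (snd (orbit p (Suc n)) - z0) * k,
        fst (orbit p (Suc n)))"
      by blast
    have "err p (Suc (Suc n)) = norm k * (err p (Suc n) * err p n)"
      unfolding k(3) elim(2) by (simp only: fst_conv add_diff_cancel_left' norm_mult mult_ac)
    then show ?case
      using k(1,2) by (simp only: mult.assoc) (intro conjI mult_right_mono; simp)
  qed
  then show thesis
    using that[OF c] by (auto simp: eventually_conj_iff)
qed

lemma secant_preimage_root_iter:
  assumes "p \<in> secant_preimage U f n {(z0, z0)}"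
  shows "secant_iter U f (n + k) p = emb (z0, z0)"
  using assms by (induction k) (auto simp: secant_preimage_def secant_map_root)

text \<open>From index \<open>n\<close> on the orbit rests at the fixed point, which settles
  definedness and convergence. The zero set is taken inside the basin, while preimages are defined
  without it; this inclusion reconciles the two.\<close>

lemma secant_preimage_root_subset_basin: "secant_preimage U f n {(z0, z0)} \<subseteq> basin U f z0"
proof
  fix p assume p: "p \<in> secant_preimage U f n {(z0, z0)}"
  have dom: "secant_dom U f \<subseteq> U \<times> U"
    unfolding secant_dom_def secant_extension_def by blast
  have late: "secant_iter U f k p = emb (z0, z0)" if "k \<ge> n" for k
    using secant_preimage_root_iter[OF p, of "k - n"] that by simp
  have "secant_iter U f k p \<in> emb ` secant_dom U f" for k
    using p late[of k] secant_map_root(2)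
    by (cases "k < n") (auto simp: secant_preimage_def secant_iter_defined_def)
  moreover have "(\<lambda>k. orbit p k) \<longlonglongrightarrow> (z0, z0)"
    by (rule tendsto_eventually, rule eventually_sequentiallyI[of n]) (simp add: late)
  ultimately show "p \<in> basin U f z0"
    using p dom by (fastforce simp: basin_def secant_iter_defined_def secant_preimage_def)
qed

text \<open>If the first coordinate of a late iterate is \<open>z0\<close>, the product in the next
  step vanishes and its second coordinate is \<open>z0\<close> too, so the orbit has reached the
  fixed point.\<close>

lemma eventually_err_positive:
  assumes p: "p \<in> basin U f z0" and no: "\<And>n. p \<notin> secant_preimage U f n {(z0, z0)}"
  shows "\<forall>\<^sub>F n in sequentially. err p n > 0"
proof -
  obtain c C where "\<forall>\<^sub>F n in sequentially. \<exists>k. c \<le> norm k \<and> norm k \<le> C \<and>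
      orbit p (Suc n) = (z0 + (fst (orbit p n) - z0) * (snd (orbit p n) - z0) * k, fst (orbit p n))"
    using orbit_step[OF p] by blast
  then show ?thesis
  proof eventually_elim
    case (elim n)
    show ?case
    proof (rule ccontr)
      assume "\<not> err p n > 0"
      then have "orbit p (Suc n) = (z0, z0)" using elim by auto
      then have "secant_iter U f (Suc n) p = emb (z0, z0)"
        using emb_aff_secant_iter[OF p] by metis
      then have "p \<in> secant_preimage U f (Suc n) {(z0, z0)}"
        using p by (auto simp: secant_preimage_def basin_def)
      with no show False by blast
    qed
  qed
qed

text \<open>The base case uses the basin: the first image is finite, so \<open>emb\<close> undoes
  \<open>aff\<close> there.\<close>

lemma secant_iter_shift:
  assumes p: "p \<in> basin U f z0"
  shows "secant_iter U f n (aff (secant_map U f p)) = secant_iter U f (Suc n) p"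
  using emb_aff_secant_iter[OF p, of 1] by (induction n) simp_all

lemma secant_map_in_basin:
  assumes p: "p \<in> basin U f z0"
  shows "aff (secant_map U f p) \<in> basin U f z0"
proof -
  let ?q = "aff (secant_map U f p)"
  have in_U: "secant_iter U f n p \<in> emb ` (U \<times> U)" and def_p: "secant_iter_defined U f n p" for n
    using p by (simp_all only: basin_def mem_Collect_eq)
  \<comment> \<open>Definedness at \<open>n\<close> concerns only indices below \<open>n\<close>, so
    the index \<open>Suc n\<close> is the one to use.\<close>
  have dom: "secant_iter U f n p \<in> emb ` secant_dom U f" for n
    using def_p[of "Suc n"] unfolding secant_iter_defined_def by blast
  obtain u where "u \<in> U \<times> U" "emb ?q = emb u"
    using in_U[of 1] secant_iter_shift[OF p, of 0] by auto
  then have q: "?q \<in> U \<times> U" by (metis aff_emb)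
  have "(\<lambda>n. orbit p (Suc n)) \<longlonglongrightarrow> (z0, z0)"
    using orbit_tendsto[OF p] by (rule LIMSEQ_Suc)
  then show ?thesis
    unfolding basin_def secant_iter_defined_def mem_Collect_eq secant_iter_shift[OF p]
    by (intro conjI allI impI q dom in_U)
qed

end

section \<open>The limit of the golden roots as a function on the basin\<close>

text \<open>The number \<open>A\<close> of the overview: the right-hand side in
  \<open>is_boettcher_modulus\<close> and the first argument of the maximum in
  \<open>boettcher_h\<close>.\<close>

definition boettcher_limit :: "complex \<Rightarrow> (complex \<times> complex \<Rightarrow> real) \<Rightarrow> complex \<times> complex \<Rightarrow> real" where
  "boettcher_limit z0 H p =
     H p * norm (fst p - z0) powr (golden / sqrt 5) * norm (snd p - z0) powr (1 / sqrt 5)"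

text \<open>The positive exponent secures continuity at the zeros of \<open>g\<close>.\<close>

lemma continuous_on_norm_powr:
  assumes "continuous_on S g" "a > 0"
  shows "continuous_on S (\<lambda>p. norm (g p :: 'a :: real_normed_vector) powr a)"
  by (rule continuous_on_powr'[OF continuous_on_norm[OF assms(1)] continuous_on_const])
     (use assms in simp)

locale secant_root_modulus = secant_root +
  fixes H :: "complex \<times> complex \<Rightarrow> real"
  assumes modulus: "is_boettcher_modulus U f z0 H"
begin

lemma err_root_tendsto:
  assumes "p \<in> basin U f z0"
  shows "(\<lambda>n. err p n powr (1 / golden ^ n)) \<longlonglongrightarrow> boettcher_limit z0 H p"
  using modulus assms unfolding is_boettcher_modulus_def boettcher_limit_def
  by (cases p) auto

lemma err_tendsto_0:
  assumes "p \<in> basin U f z0"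
  shows "err p \<longlonglongrightarrow> 0"
  using tendsto_fst[OF orbit_tendsto[OF assms]] by (simp add: tendsto_norm_zero LIM_zero)

lemma boettcher_limit_nonneg: "p \<in> basin U f z0 \<Longrightarrow> boettcher_limit z0 H p \<ge> 0"
  by (rule LIMSEQ_le_const[OF err_root_tendsto]) auto

lemma boettcher_limit_less_1:
  assumes p: "p \<in> basin U f z0"
  shows "boettcher_limit z0 H p < 1"
proof -
  obtain C where C: "0 < C" "\<forall>\<^sub>F n in sequentially. err p (Suc (Suc n)) \<le> C * err p (Suc n) * err p n"
    using err_recurrence[OF p] by blast
  show ?thesis
    by (rule golden_root_limit_less_1[OF _ C err_tendsto_0[OF p] err_root_tendsto[OF p]]) simp
qed

text \<open>An orbit avoiding the fixed point eventually has positive errors, which force a positive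
  limit; an orbit reaching it has errors that are eventually 0.\<close>

lemma boettcher_limit_eq_0_iff:
  assumes p: "p \<in> basin U f z0"
  shows "boettcher_limit z0 H p = 0 \<longleftrightarrow> (\<exists>n. p \<in> secant_preimage U f n {(z0, z0)})"
proof
  assume 0: "boettcher_limit z0 H p = 0"
  obtain c where c: "0 < c" "\<forall>\<^sub>F n in sequentially. c * err p (Suc n) * err p n \<le> err p (Suc (Suc n))"
    using err_recurrence[OF p] by blast
  show "\<exists>n. p \<in> secant_preimage U f n {(z0, z0)}"
    using golden_root_limit_positive[OF eventually_err_positive[OF p] c err_root_tendsto[OF p]] 0
    by force
next
  assume "\<exists>n. p \<in> secant_preimage U f n {(z0, z0)}"
  then obtain n where n: "p \<in> secant_preimage U f n {(z0, z0)}" ..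
  have "(\<lambda>k. err p k powr (1 / golden ^ k)) \<longlonglongrightarrow> 0"
  proof (rule tendsto_eventually, unfold eventually_sequentially, intro exI[of _ n] allI impI)
    fix k assume "n \<le> k"
    then show "err p k powr (1 / golden ^ k) = 0"
      using secant_preimage_root_iter[OF n, of "k - n"] by simp
  qed
  then show "boettcher_limit z0 H p = 0"
    using LIMSEQ_unique err_root_tendsto[OF p] by blast
qed

text \<open>The errors of the image are those of \<open>p\<close> shifted by one index, and one
  index changes the order of the root by the factor \<open>golden\<close>.\<close>

lemma boettcher_limit_secant_map:
  assumes p: "p \<in> basin U f z0"
  shows "boettcher_limit z0 H (aff (secant_map U f p)) = boettcher_limit z0 H p powr golden"
proof -
  let ?q = "aff (secant_map U f p)"
  have "(\<lambda>n. (err p (Suc n) powr (1 / golden ^ Suc n)) powr golden) \<longlonglongrightarrow> boettcher_limit z0 H p powr golden"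
    using golden_pos by (intro tendsto_powr2 LIMSEQ_Suc[OF err_root_tendsto[OF p]] tendsto_const) auto
  moreover have "(err p (Suc n) powr (1 / golden ^ Suc n)) powr golden = err ?q n powr (1 / golden ^ n)" for n
    using golden_pos unfolding secant_iter_shift[OF p] powr_powr by simp
  ultimately show ?thesis
    using err_root_tendsto[OF secant_map_in_basin[OF p]] LIMSEQ_unique by simp
qed

lemma boettcher_limit_powr:
  assumes p: "p \<in> basin U f z0"
  shows "boettcher_limit z0 H p powr (1 / golden) =
    H p powr (1 / golden) * norm (fst p - z0) powr (1 / sqrt 5) * norm (snd p - z0) powr (inverse golden / sqrt 5)"
\<comment> \<open>If a coordinate is \<open>z0\<close>, both sides vanish whatever
  \<open>H p\<close> is. Otherwise nonnegativity of the limit forces \<open>H p \<ge> 0\<close>, and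
  the power is taken factor by factor.\<close>
proof (cases "fst p = z0 \<or> snd p = z0")
  case False
  then have "norm (fst p - z0) powr (golden / sqrt 5) * norm (snd p - z0) powr (1 / sqrt 5) > 0" by simp
  then have "H p \<ge> 0"
    using boettcher_limit_nonneg[OF p] unfolding boettcher_limit_def mult.assoc
    by (metis not_less mult_neg_pos)
  moreover have "golden / sqrt 5 * (1 / golden) = 1 / sqrt 5"
    "1 / sqrt 5 * (1 / golden) = inverse golden / sqrt 5"
    using golden_pos by (simp_all add: field_simps)
  ultimately show ?thesis
    unfolding boettcher_limit_def by (simp only: powr_mult powr_powr mult_nonneg_nonneg powr_ge_zero)
qed (auto simp: boettcher_limit_def)

text \<open>For a base in \<open>[0, 1)\<close> the smaller exponent gives the larger power, so the
  maximum is always its second argument.\<close>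

lemma boettcher_h_eq:
  assumes p: "p \<in> basin U f z0"
  shows "boettcher_h z0 H p = boettcher_limit z0 H p powr (1 / golden)"
proof -
  have "boettcher_limit z0 H p powr 1 \<le> boettcher_limit z0 H p powr (1 / golden)"
    using boettcher_limit_nonneg[OF p] boettcher_limit_less_1[OF p] golden_gt_1
    by (intro powr_mono') auto
  then have "boettcher_limit z0 H p \<le> boettcher_limit z0 H p powr (1 / golden)"
    using boettcher_limit_nonneg[OF p] by simp
  moreover have "boettcher_h z0 H p = max (boettcher_limit z0 H p) (boettcher_limit z0 H p powr (1 / golden))"
    unfolding boettcher_limit_powr[OF p] by (cases p) (simp add: boettcher_h_def boettcher_limit_def)
  ultimately show ?thesis by simp
qed

lemma continuous_on_boettcher_h: "continuous_on (basin U f z0) (boettcher_h z0 H)"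
proof -
  have H: "continuous_on (basin U f z0) H"
    using modulus unfolding is_boettcher_modulus_def by (rule conjunct1)
  have "continuous_on (basin U f z0) (boettcher_limit z0 H)"
    unfolding boettcher_limit_def[abs_def]
    using golden_pos
    by (intro continuous_on_mult H continuous_on_norm_powr continuous_intros) auto
  then have "continuous_on (basin U f z0) (\<lambda>p. boettcher_limit z0 H p powr (1 / golden))"
    by (rule continuous_on_powr'[OF _ continuous_on_const])
       (use boettcher_limit_nonneg golden_pos in simp)
  then show ?thesis
    by (rule continuous_on_eq) (simp add: boettcher_h_eq)
qed

lemma norm_root_tendsto:
  assumes N: "is_norm_C2 N" and p: "p \<in> basin U f z0"
  shows "(\<lambda>n. N (orbit p n - (z0, z0)) powr (1 / golden ^ n)) \<longlonglongrightarrow> boettcher_h z0 H p"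
proof -
  obtain c C where c: "0 < c" "0 < C"
    "\<forall>v. c * max (norm (fst v)) (norm (snd v)) \<le> N v"
    "\<forall>v. N v \<le> C * max (norm (fst v)) (norm (snd v))"
    by (rule norm_C2_equivalent_max[OF N])
  define M where "M n = max (norm (fst (orbit p n) - z0)) (norm (snd (orbit p n) - z0)) powr (1 / golden ^ n)" for n
  have limit_max: "max (boettcher_limit z0 H p) (boettcher_limit z0 H p powr (1 / golden)) = boettcher_h z0 H p"
    unfolding boettcher_limit_powr[OF p] by (cases p) (simp add: boettcher_h_def boettcher_limit_def)
  \<comment> \<open>At index \<open>n + 1\<close> the second coordinate contributes
    \<open>err p n\<close> with a root of order \<open>golden ^ (n + 1)\<close>, that is, a further
    \<open>golden\<close>-th root of a sequence whose limit is known.\<close>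
  have "(\<lambda>n. max (err p (Suc n) powr (1 / golden ^ Suc n)) ((err p n powr (1 / golden ^ n)) powr (1 / golden)))
      \<longlonglongrightarrow> boettcher_h z0 H p"
    unfolding limit_max[symmetric] using golden_pos
    by (intro tendsto_max tendsto_powr2 LIMSEQ_Suc[OF err_root_tendsto[OF p]] err_root_tendsto[OF p] tendsto_const) auto
  moreover have "\<forall>\<^sub>F n in sequentially.
      max (err p (Suc n) powr (1 / golden ^ Suc n)) ((err p n powr (1 / golden ^ n)) powr (1 / golden)) = M (Suc n)"
    using eventually_snd_orbit[OF p]
  proof eventually_elim
    case (elim n)
    have mono: "a powr t \<le> b powr t" if "0 \<le> a" "a \<le> b" "0 \<le> t" for a b t :: real
      using that by (intro powr_mono2) auto
    have max_powr: "max (a powr t) (b powr t) = max a b powr t" if "0 \<le> a" "0 \<le> b" "0 \<le> t" for a b t :: real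
      using mono[of a b t] mono[of b a t] that by (auto simp: max_def)
    have "(err p n powr (1 / golden ^ n)) powr (1 / golden) = err p n powr (1 / golden ^ Suc n)"
      by (simp add: powr_powr mult.commute)
    then show ?case
      unfolding M_def elim using golden_pos by (simp only: max_powr norm_ge_zero divide_nonneg_nonneg zero_le_one zero_le_power less_imp_le)
  qed
  ultimately have "(\<lambda>n. M (Suc n)) \<longlonglongrightarrow> boettcher_h z0 H p"
    by (rule Lim_transform_eventually)
  then have M_lim: "M \<longlonglongrightarrow> boettcher_h z0 H p" by (rule LIMSEQ_imp_Suc)
  \<comment> \<open>Applied to the two constants of norm equivalence, this gives a lower and an
    upper sequence with the same limit.\<close>
  have scaled: "(\<lambda>n. s powr (1 / golden ^ n) * M n) \<longlonglongrightarrow> boettcher_h z0 H p" if "s > 0" for s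
    using tendsto_mult[OF powr_inverse_golden_power_tendsto_1[OF that] M_lim] by simp
  have N_nonneg: "N v \<ge> 0" for v
    using c(1) order_trans[OF _ c(3)[rule_format, of v]] by (simp add: le_max_iff_disj)
  have lower: "c powr (1 / golden ^ n) * M n \<le> N (orbit p n - (z0, z0)) powr (1 / golden ^ n)" for n
    unfolding M_def using c(1) c(3)[rule_format, of "orbit p n - (z0, z0)"] golden_pos
    by (subst powr_mult[symmetric]) (auto simp: le_max_iff_disj intro!: powr_mono2)
  have upper: "N (orbit p n - (z0, z0)) powr (1 / golden ^ n) \<le> C powr (1 / golden ^ n) * M n" for n
    unfolding M_def using c(2) c(4)[rule_format, of "orbit p n - (z0, z0)"] golden_pos N_nonneg
    by (subst powr_mult[symmetric]) (auto simp: le_max_iff_disj intro!: powr_mono2 N_nonneg)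
  show ?thesis
    by (rule tendsto_sandwich[OF _ _ scaled[OF c(1)] scaled[OF c(2)]]) (use lower upper in auto)
qed

end

theorem corollary3p2:
  fixes U :: "complex set" and f :: "complex \<Rightarrow> complex" and z0 :: complex
    and H :: "complex \<times> complex \<Rightarrow> real"
  assumes "open U" and "connected U"
    and "f nicely_meromorphic_on U" and "\<not> f constant_on U"
    and "z0 \<in> U" and "\<not> is_pole f z0" and "f z0 = 0" and "deriv f z0 \<noteq> 0"
    and "deriv (deriv f) z0 \<noteq> 0"
    and "is_boettcher_modulus U f z0 H"
  shows "continuous_on (basin U f z0) (boettcher_h z0 H)
    \<and> (\<forall>p \<in> basin U f z0.
         boettcher_h z0 H (aff (secant_map U f p)) = boettcher_h z0 H p powr golden)
    \<and> (\<forall>N. is_norm_C2 N \<longrightarrow> (\<forall>p \<in> basin U f z0.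
         (\<lambda>n. N (aff (secant_iter U f n p) - (z0, z0)) powr (1 / golden ^ n))
           \<longlonglongrightarrow> boettcher_h z0 H p))
    \<and> {p \<in> basin U f z0. boettcher_h z0 H p = 0} = (\<Union>n. secant_preimage U f n {(z0, z0)})
    \<and> (\<forall>(x, y) \<in> basin U f z0.
         0 \<le> boettcher_h z0 H (x, y) \<and> boettcher_h z0 H (x, y) < 1 \<and>
         boettcher_h z0 H (x, y) = H (x, y) powr (1 / golden) * norm (x - z0) powr (1 / sqrt 5)
           * norm (y - z0) powr (inverse golden / sqrt 5))"
proof -
  \<comment> \<open>For a nicely meromorphic function, a point that is not a pole is a point of
    analyticity.\<close>
  interpret secant_root_modulus U f z0 H
    by unfold_locales (rule assms nicely_meromorphic_on_imp_analytic_at[OF assms(3,5,6)])+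
  show ?thesis
  proof (intro conjI)
    show "continuous_on (basin U f z0) (boettcher_h z0 H)"
      by (rule continuous_on_boettcher_h)
    show "\<forall>p \<in> basin U f z0.
        boettcher_h z0 H (aff (secant_map U f p)) = boettcher_h z0 H p powr golden"
      \<comment> \<open>Both sides reduce to powers of the same limit; the exponents
        \<open>golden\<close> and \<open>1 / golden\<close> commute.\<close>
      by (simp add: boettcher_h_eq secant_map_in_basin boettcher_limit_secant_map powr_powr mult.commute)
    show "\<forall>N. is_norm_C2 N \<longrightarrow> (\<forall>p \<in> basin U f z0.
        (\<lambda>n. N (aff (secant_iter U f n p) - (z0, z0)) powr (1 / golden ^ n)) \<longlonglongrightarrow> boettcher_h z0 H p)"
      using norm_root_tendsto by blast
    show "{p \<in> basin U f z0. boettcher_h z0 H p = 0} = (\<Union>n. secant_preimage U f n {(z0, z0)})"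
    proof -
      have "boettcher_h z0 H p = 0 \<longleftrightarrow> (\<exists>n. p \<in> secant_preimage U f n {(z0, z0)})"
        if "p \<in> basin U f z0" for p
        unfolding boettcher_h_eq[OF that] powr_eq_0_iff by (rule boettcher_limit_eq_0_iff[OF that])
      then show ?thesis using secant_preimage_root_subset_basin by blast
    qed
    show "\<forall>(x, y) \<in> basin U f z0.
        0 \<le> boettcher_h z0 H (x, y) \<and> boettcher_h z0 H (x, y) < 1 \<and>
        boettcher_h z0 H (x, y) = H (x, y) powr (1 / golden) * norm (x - z0) powr (1 / sqrt 5)
          * norm (y - z0) powr (inverse golden / sqrt 5)"
    proof (clarify, intro conjI)
      fix x y assume p: "(x, y) \<in> basin U f z0"
      show "0 \<le> boettcher_h z0 H (x, y)" by (simp add: boettcher_h_eq[OF p])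
      have "boettcher_limit z0 H (x, y) powr (1 / golden) < 1 powr (1 / golden)"
        using boettcher_limit_nonneg[OF p] boettcher_limit_less_1[OF p] golden_pos
        by (intro powr_less_mono2) auto
      then show "boettcher_h z0 H (x, y) < 1" by (simp add: boettcher_h_eq[OF p])
      show "boettcher_h z0 H (x, y) = H (x, y) powr (1 / golden) * norm (x - z0) powr (1 / sqrt 5)
          * norm (y - z0) powr (inverse golden / sqrt 5)"
        using boettcher_limit_powr[OF p] by (simp add: boettcher_h_eq[OF p])
    qed
  qed
qed

end
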